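(* Let $\alpha,\beta\in\mathbb{R}$ be constants with $\alpha^2+\beta^2\neq0$. Let $T^2$ be a flat torus and $\varphi:T^2\rightarrow\mathbb{S}^3(1)$ an isometric immersion with constant mean curvature $\mathcal{H}$. Then $\varphi$ is an $(\alpha\mathcal{Q}_1+\beta\mathcal{Q}_2)$-map if and only if (i) $\mathcal{H}=0$ (when $\alpha+\beta=0$), (ii) $\mathcal{H}=0$ (when $\alpha+\beta\neq0$ and $\frac{\alpha}{\alpha+\beta}\geq0$), (iii) $\mathcal{H}=0$ or $\mathcal{H}^2=-\frac{\alpha}{2(\alpha+\beta)}$ (when $\alpha+\beta\neq0$ and $\frac{\alpha}{\alpha+\beta}<0$). Moreover, in the case of (iii), the value $\mathcal{H}^2=-\frac{\alpha}{2(\alpha+\beta)}$ runs across the whole range of $(0,\infty)$ (as $(\alpha,\beta)$ varies over the pairs satisfying the condition in (iii)).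
   Context: $\mathbb{S}^3(1)$ is the round unit $3$-sphere. The mean curvature $\mathcal{H}$ is the scalar function with mean curvature vector $\frac12\mathrm{tr}\,h=\mathcal{H}\xi$, $\xi$ a unit normal vector field along $\varphi$, $h$ the second fundamental form. For an isometric immersion $\varphi:M\to N$ between Riemannian manifolds, with $\overline{\nabla}$ the pull-back connection on $\varphi^{-1}TN$, put $(\widetilde{\nabla}d\varphi)(X,Y)=\overline{\nabla}_X(d\varphi(Y))-d\varphi(\nabla_XY)$, $(\widetilde{\nabla}^2d\varphi)(X,Y,Z)=\overline{\nabla}_X((\widetilde{\nabla}d\varphi)(Y,Z))-(\widetilde{\nabla}d\varphi)(\nabla_XY,Z)-(\widetilde{\nabla}d\varphi)(Y,\nabla_XZ)$, and let $(\widetilde{\nabla}^3d\varphi)(X,Y,Z,W)$ be the covariant derivative of $\widetilde{\nabla}^2d\varphi$ in direction $X$ evaluated at $(Y,Z,W)$. With a local orthonormal frame $\{e_i\}$ of $M$ and $R(X,Y)=\nabla_X\nabla_Y-\nabla_Y\nabla_X-\nabla_{[X,Y]}$, set $W_1(\varphi)=\sum_{i,j}\{(\widetilde{\nabla}^3d\varphi)(e_i,e_j,e_i,e_j)+R^N((\widetilde{\nabla}d\varphi)(e_i,e_j),d\varphi(e_i))d\varphi(e_j)\}$, $W_2(\varphi)=\sum_{i,j}\{(\widetilde{\nabla}^3d\varphi)(e_i,e_i,e_j,e_j)+R^N((\widetilde{\nabla}d\varphi)(e_i,e_i),d\varphi(e_j))d\varphi(e_j)\}$. $\varphi$ is called an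 $(\alpha\mathcal{Q}_1+\beta\mathcal{Q}_2)$-map if $\alpha W_1(\varphi)+\beta W_2(\varphi)=0$. *)

theory Defs
  imports "HOL-Analysis.Analysis"
begin

section \<open>Smooth maps between Euclidean spaces\<close>

primrec Ck :: "nat \<Rightarrow> ('a::euclidean_space \<Rightarrow> 'b::euclidean_space) \<Rightarrow> bool" where
  "Ck 0 f = continuous_on UNIV f"
| "Ck (Suc k) f = ((\<forall>x. f differentiable at x) \<and>
     (\<forall>v. Ck k (\<lambda>x. frechet_derivative f (at x) v)))"

definition smooth :: "('a::euclidean_space \<Rightarrow> 'b::euclidean_space) \<Rightarrow> bool" where
  "smooth f \<longleftrightarrow> (\<forall>k. Ck k f)"

text \<open>The derivative \<open>D\<^sub>X V\<close> of \<open>V\<close> along the vector field \<open>X\<close>; for a map \<open>f\<close> it is also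
  the vector field \<open>df(X)\<close> along \<open>f\<close>.\<close>

definition ddir :: "('a::euclidean_space \<Rightarrow> 'a) \<Rightarrow> ('a \<Rightarrow> 'b::euclidean_space) \<Rightarrow> 'a \<Rightarrow> 'b" where
  "ddir X V = (\<lambda>p. frechet_derivative V (at p) (X p))"


section \<open>The unit sphere with its round metric\<close>

text \<open>The tangent space of the unit sphere at \<open>q\<close> is the orthogonal complement of \<open>q\<close>.
  Vector fields on the sphere are represented by ambient fields; the Levi-Civita connection is
  the tangential part of the ambient derivative. For tangent \<open>X\<close>, its values on the
  sphere depend only on the values of \<open>X\<close> and \<open>Y\<close> there.\<close>

definition tan_proj :: "'b::euclidean_space \<Rightarrow> 'b \<Rightarrow> 'b" where
  "tan_proj q v = v - (v \<bullet> q) *\<^sub>R q"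

definition sphere_conn :: "('b::euclidean_space \<Rightarrow> 'b) \<Rightarrow> ('b \<Rightarrow> 'b) \<Rightarrow> 'b \<Rightarrow> 'b" where
  "sphere_conn X Y = (\<lambda>q. tan_proj q (ddir X Y q))"

definition lie_bracket :: "('b::euclidean_space \<Rightarrow> 'b) \<Rightarrow> ('b \<Rightarrow> 'b) \<Rightarrow> 'b \<Rightarrow> 'b" where
  "lie_bracket X Y = (\<lambda>q. ddir X Y q - ddir Y X q)"

definition sphere_curv_field ::
  "('b::euclidean_space \<Rightarrow> 'b) \<Rightarrow> ('b \<Rightarrow> 'b) \<Rightarrow> ('b \<Rightarrow> 'b) \<Rightarrow> 'b \<Rightarrow> 'b" where
  "sphere_curv_field X Y Z = (\<lambda>q. sphere_conn X (sphere_conn Y Z) q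
     - sphere_conn Y (sphere_conn X Z) q - sphere_conn (lie_bracket X Y) Z q)"

text \<open>The curvature is tensorial, so its value on tangent vectors \<open>u, v, w\<close> at \<open>q\<close> may be computed
  with any tangent extensions of them; here the tangential parts of constant fields are used.\<close>

definition sphere_curv :: "'b::euclidean_space \<Rightarrow> 'b \<Rightarrow> 'b \<Rightarrow> 'b \<Rightarrow> 'b" where
  "sphere_curv q u v w =
     sphere_curv_field (\<lambda>p. tan_proj p u) (\<lambda>p. tan_proj p v) (\<lambda>p. tan_proj p w) q"

lemma frechet_derivative_eqI: "(f has_derivative f') (at x) \<Longrightarrow> frechet_derivative f (at x) = f'"
  by (metis frechet_derivative_at)

lemma ddir_tan_proj: "ddir X (\<lambda>p. tan_proj p w) p = - ((w \<bullet> X p) *\<^sub>R p + (w \<bullet> p) *\<^sub>R X p)"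
proof -
  have "((\<lambda>p. tan_proj p w) has_derivative (\<lambda>h. - ((w \<bullet> h) *\<^sub>R p + (w \<bullet> p) *\<^sub>R h))) (at p)"
    unfolding tan_proj_def by (auto intro!: derivative_eq_intros simp: algebra_simps)
  from frechet_derivative_eqI[OF this] show ?thesis unfolding ddir_def by simp
qed

lemma sphere_conn_tan_proj: "sphere_conn (\<lambda>p. tan_proj p v) (\<lambda>p. tan_proj p w) = (\<lambda>p. tan_proj p (- ((w \<bullet> tan_proj p v) *\<^sub>R p + (w \<bullet> p) *\<^sub>R tan_proj p v)))"
  unfolding sphere_conn_def ddir_tan_proj by simp

lemma ddir_tan_proj2: "ddir X (\<lambda>p. tan_proj p (- ((w \<bullet> tan_proj p v) *\<^sub>R p + (w \<bullet> p) *\<^sub>R tan_proj p v))) q =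
  (let h = X q; g = (\<lambda>p. - ((w \<bullet> tan_proj p v) *\<^sub>R p + (w \<bullet> p) *\<^sub>R tan_proj p v));
   T = (- ((v \<bullet> h) *\<^sub>R q + (v \<bullet> q) *\<^sub>R h)); 
   dg = - ((w \<bullet> T) *\<^sub>R q + (w \<bullet> tan_proj q v) *\<^sub>R h + (w \<bullet> h) *\<^sub>R tan_proj q v + (w \<bullet> q) *\<^sub>R T)
   in dg - (dg \<bullet> q + g q \<bullet> h) *\<^sub>R q - (g q \<bullet> q) *\<^sub>R h)"
proof -
  have T: "((\<lambda>p. tan_proj p v) has_derivative (\<lambda>h. - ((v \<bullet> h) *\<^sub>R q + (v \<bullet> q) *\<^sub>R h))) (at q)"
    unfolding tan_proj_def by (auto intro!: derivative_eq_intros simp: algebra_simps)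
  let ?g = "\<lambda>p. - ((w \<bullet> tan_proj p v) *\<^sub>R p + (w \<bullet> p) *\<^sub>R tan_proj p v)"
  let ?T = "\<lambda>h. - ((v \<bullet> h) *\<^sub>R q + (v \<bullet> q) *\<^sub>R h)"
  let ?dg = "\<lambda>h. - ((w \<bullet> ?T h) *\<^sub>R q + (w \<bullet> tan_proj q v) *\<^sub>R h + (w \<bullet> h) *\<^sub>R tan_proj q v + (w \<bullet> q) *\<^sub>R ?T h)"
  have G: "(?g has_derivative ?dg) (at q)"
    by (rule derivative_eq_intros T refl | simp add: algebra_simps)+
  have "((\<lambda>p. ?g p - (?g p \<bullet> p) *\<^sub>R p) has_derivative (\<lambda>h. ?dg h - (?dg h \<bullet> q + ?g q \<bullet> h) *\<^sub>R q - (?g q \<bullet> q) *\<^sub>R h)) (at q)"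
    by (rule has_derivative_eq_rhs, rule has_derivative_diff[OF G], rule has_derivative_scaleR[OF has_derivative_inner[OF G has_derivative_ident] has_derivative_ident])
     (simp add: algebra_simps fun_eq_iff)
  from frechet_derivative_eqI[OF this] show ?thesis unfolding ddir_def tan_proj_def[of _ "-_"] Let_def by simp
qed

text \<open>The unit sphere has constant curvature \<open>1\<close>.\<close>

lemma sphere_curv_eq: "norm q = 1 \<Longrightarrow> u \<bullet> q = 0 \<Longrightarrow> v \<bullet> q = 0 \<Longrightarrow> w \<bullet> q = 0 \<Longrightarrow>
  sphere_curv q u v w = (v \<bullet> w) *\<^sub>R u - (u \<bullet> w) *\<^sub>R v"
proof -
  assume a: "norm q = 1" "u \<bullet> q = 0" "v \<bullet> q = 0" "w \<bullet> q = 0"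
  have qq: "q \<bullet> q = 1" using a by (simp add: norm_eq_1)
  have b: "q \<bullet> u = 0" "q \<bullet> v = 0" "q \<bullet> w = 0" using a by (simp_all add: inner_commute)
  have t: "tan_proj q u = u" "tan_proj q v = v" "tan_proj q w = w" using a by (simp_all add: tan_proj_def)
  have s: "sphere_conn X Y q = tan_proj q (ddir X Y q)" for X Y :: "'a \<Rightarrow> 'a" by (simp add: sphere_conn_def)
  show ?thesis
    unfolding sphere_curv_def sphere_curv_field_def sphere_conn_tan_proj s ddir_tan_proj2 ddir_tan_proj Let_def lie_bracket_def
    by (simp add: t a b qq ddir_tan_proj tan_proj_def inner_simps algebra_simps inner_commute)
qed


section \<open>Flat tori\<close>

definition lattice2 :: "real^2 \<Rightarrow> real^2 \<Rightarrow> (real^2) set" where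
  "lattice2 a b = {of_int m *\<^sub>R a + of_int n *\<^sub>R b | m n :: int. True}"

text \<open>For linearly independent \<open>a, b\<close>, the flat torus with period lattice \<open>\<Lambda> = lattice2 a b\<close> is the
  quotient of the Euclidean plane by \<open>\<Lambda>\<close>, its points being the cosets of \<open>\<Lambda>\<close>. The
  projection \<open>torus_proj a b\<close> is a Riemannian covering, and smooth structure, metric, tangent vectors
  and connection of the torus are expressed through it: maps and vector fields on the
  torus are treated through their lifts to the plane.\<close>

definition torus_proj :: "real^2 \<Rightarrow> real^2 \<Rightarrow> real^2 \<Rightarrow> (real^2) set" where
  "torus_proj a b p = {p + l | l. l \<in> lattice2 a b}"

definition lift :: "real^2 \<Rightarrow> real^2 \<Rightarrow> ((real^2) set \<Rightarrow> 'b) \<Rightarrow> real^2 \<Rightarrow> 'b" where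
  "lift a b \<phi> = \<phi> \<circ> torus_proj a b"

text \<open>A smooth map into the unit sphere that pulls the round metric back to the flat one.\<close>

definition isometric_immersion_torus ::
  "real^2 \<Rightarrow> real^2 \<Rightarrow> ((real^2) set \<Rightarrow> 'b::euclidean_space) \<Rightarrow> bool" where
  "isometric_immersion_torus a b \<phi> \<longleftrightarrow>
     smooth (lift a b \<phi>) \<and>
     (\<forall>p. lift a b \<phi> p \<in> sphere 0 1) \<and>
     (\<forall>p u v. frechet_derivative (lift a b \<phi>) (at p) u
                \<bullet> frechet_derivative (lift a b \<phi>) (at p) v = u \<bullet> v)"


section \<open>Iterated covariant derivatives of the differential\<close>

text \<open>In the following, \<open>f\<close> is (the lift of) a map from a flat manifold to the unit sphere. The Levi-Civita
  connection \<open>\<nabla>\<^sub>X Y\<close> of the flat metric is \<open>ddir X Y\<close>. The pull-back connection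
  acts on vector fields \<open>V\<close> along \<open>f\<close>, i.e. \<open>V p\<close> is orthogonal to \<open>f p\<close>.\<close>

definition pb_conn ::
  "('a::euclidean_space \<Rightarrow> 'b::euclidean_space) \<Rightarrow> ('a \<Rightarrow> 'a) \<Rightarrow> ('a \<Rightarrow> 'b) \<Rightarrow> 'a \<Rightarrow> 'b" where
  "pb_conn f X V = (\<lambda>p. tan_proj (f p) (ddir X V p))"

definition nabla_d ::
  "('a::euclidean_space \<Rightarrow> 'b::euclidean_space) \<Rightarrow> ('a \<Rightarrow> 'a) \<Rightarrow> ('a \<Rightarrow> 'a) \<Rightarrow> 'a \<Rightarrow> 'b" where
  "nabla_d f X Y = (\<lambda>p. pb_conn f X (ddir Y f) p - ddir (ddir X Y) f p)"

definition nabla2_d ::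
  "('a::euclidean_space \<Rightarrow> 'b::euclidean_space) \<Rightarrow> ('a \<Rightarrow> 'a) \<Rightarrow> ('a \<Rightarrow> 'a) \<Rightarrow> ('a \<Rightarrow> 'a) \<Rightarrow> 'a \<Rightarrow> 'b"
where
  "nabla2_d f X Y Z = (\<lambda>p. pb_conn f X (nabla_d f Y Z) p
     - nabla_d f (ddir X Y) Z p - nabla_d f Y (ddir X Z) p)"

definition nabla3_d ::
  "('a::euclidean_space \<Rightarrow> 'b::euclidean_space) \<Rightarrow>
   ('a \<Rightarrow> 'a) \<Rightarrow> ('a \<Rightarrow> 'a) \<Rightarrow> ('a \<Rightarrow> 'a) \<Rightarrow> ('a \<Rightarrow> 'a) \<Rightarrow> 'a \<Rightarrow> 'b"
where
  "nabla3_d f X Y Z W = (\<lambda>p. pb_conn f X (nabla2_d f Y Z W) p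
     - nabla2_d f (ddir X Y) Z W p - nabla2_d f Y (ddir X Z) W p - nabla2_d f Y Z (ddir X W) p)"

text \<open>The coordinate frame is a global orthonormal frame of the plane that descends to every flat
  torus. The traces below do not depend on the choice of a local orthonormal frame.\<close>

definition frame :: "2 \<Rightarrow> real^2 \<Rightarrow> real^2" where
  "frame i = (\<lambda>p. axis i 1)"

definition W1 :: "(real^2 \<Rightarrow> 'b::euclidean_space) \<Rightarrow> real^2 \<Rightarrow> 'b" where
  "W1 f p = (\<Sum>i\<in>UNIV. \<Sum>j\<in>UNIV.
     nabla3_d f (frame i) (frame j) (frame i) (frame j) p
     + sphere_curv (f p) (nabla_d f (frame i) (frame j) p) (ddir (frame i) f p) (ddir (frame j) f p))"

definition W2 :: "(real^2 \<Rightarrow> 'b::euclidean_space) \<Rightarrow> real^2 \<Rightarrow> 'b" where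
  "W2 f p = (\<Sum>i\<in>UNIV. \<Sum>j\<in>UNIV.
     nabla3_d f (frame i) (frame i) (frame j) (frame j) p
     + sphere_curv (f p) (nabla_d f (frame i) (frame i) p) (ddir (frame j) f p) (ddir (frame j) f p))"

definition Q_map_torus ::
  "real^2 \<Rightarrow> real^2 \<Rightarrow> real \<Rightarrow> real \<Rightarrow> ((real^2) set \<Rightarrow> 'b::euclidean_space) \<Rightarrow> bool" where
  "Q_map_torus a b \<alpha> \<beta> \<phi> \<longleftrightarrow>
     (\<forall>p. \<alpha> *\<^sub>R W1 (lift a b \<phi>) p + \<beta> *\<^sub>R W2 (lift a b \<phi>) p = 0)"


section \<open>Mean curvature\<close>

definition unit_normal_torus ::
  "real^2 \<Rightarrow> real^2 \<Rightarrow> ((real^2) set \<Rightarrow> 'b::euclidean_space) \<Rightarrow> ((real^2) set \<Rightarrow> 'b) \<Rightarrow> bool" where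
  "unit_normal_torus a b \<phi> \<xi> \<longleftrightarrow>
     smooth (lift a b \<xi>) \<and>
     (\<forall>p. norm (lift a b \<xi> p) = 1 \<and> lift a b \<xi> p \<bullet> lift a b \<phi> p = 0 \<and>
        (\<forall>u. lift a b \<xi> p \<bullet> frechet_derivative (lift a b \<phi>) (at p) u = 0))"

text \<open>By the Gauss formula, the second fundamental form of an isometric immersion is \<open>nabla_d\<close>.\<close>

definition mean_curvature_vector :: "(real^2 \<Rightarrow> 'b::euclidean_space) \<Rightarrow> real^2 \<Rightarrow> 'b" where
  "mean_curvature_vector f p = (1/2) *\<^sub>R (\<Sum>i\<in>UNIV. nabla_d f (frame i) (frame i) p)"

definition mean_curvature_torus ::
  "real^2 \<Rightarrow> real^2 \<Rightarrow> ((real^2) set \<Rightarrow> 'b::euclidean_space) \<Rightarrow> ((real^2) set \<Rightarrow> 'b) \<Rightarrow>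
   ((real^2) set \<Rightarrow> real) \<Rightarrow> bool" where
  "mean_curvature_torus a b \<phi> \<xi> H \<longleftrightarrow>
     (\<forall>p. mean_curvature_vector (lift a b \<phi>) p = lift a b H p *\<^sub>R lift a b \<xi> p)"

end

theory Submission
  imports Defs
begin

text \<open>
  Lift the immersion to a map \<open>f\<close> of the plane into the unit sphere of \<open>\<real>\<^sup>4\<close>, write \<open>f\<^sub>i\<close> for its
  partial derivatives, \<open>\<delta>\<^sub>i\<^sub>j\<close> for the Kronecker symbol and \<open>h\<^sub>i\<^sub>j = f\<^sub>i\<^sub>j \<bullet> \<xi>\<close> for the coefficients of
  the second fundamental form. The vectors \<open>f, f\<^sub>1, f\<^sub>2, \<xi>\<close> form an orthonormal frame of \<open>\<real>\<^sup>4\<close> at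
  each point, and expanding derivatives in it gives the structure equations:
  the Gauss formula \<open>f\<^sub>i\<^sub>j = h\<^sub>i\<^sub>j \<xi> - \<delta>\<^sub>i\<^sub>j f\<close> (\<open>gauss_formula\<close>), the Weingarten formula
  \<open>\<xi>\<^sub>k = - \<Sum>\<^sub>l h\<^sub>k\<^sub>l f\<^sub>l\<close> (\<open>weingarten\<close>), the Gauss equation \<open>det h = - 1\<close> (\<open>gauss_equation\<close>) and the
  symmetry of \<open>\<partial>\<^sub>k h\<^sub>i\<^sub>j\<close> in its indices (\<open>codazzi\<close>). The last two come from the equality of mixed partial
  derivatives (\<open>ddir_commute\<close>).

  The key point is that \<open>h\<close> is constant (\<open>pd_h_eq_zero\<close>): its trace \<open>2H\<close> and its determinant are
  constant, and with the Codazzi equations this becomes a homogeneous linear system for the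
  derivatives of \<open>h\<close> whose determinant is \<open>H\<^sup>2 + 1 > 0\<close>.

  With constant \<open>h\<close> the iterated covariant derivatives are algebraic in \<open>h\<close>: one has
  \<open>(\<nabla>\<^sup>3df)(e\<^sub>m, e\<^sub>k, e\<^sub>i, e\<^sub>j) = - h\<^sub>i\<^sub>j (h\<^sup>2)\<^sub>k\<^sub>m \<xi>\<close> (\<open>nabla3_d_constant_h\<close>). The sphere has
  curvature one, so \<open>W\<^sub>1 = (tr h - tr h\<^sup>3) \<xi>\<close> and \<open>W\<^sub>2 = (2 tr h - tr h tr h\<^sup>2) \<xi>\<close>. Since \<open>tr h = 2H\<close> and
  \<open>det h = - 1\<close>, these are \<open>W\<^sub>1 = (- 4H - 8H\<^sup>3) \<xi>\<close> and \<open>W\<^sub>2 = - 8H\<^sup>3 \<xi>\<close>, whence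
  \<open>\<alpha> W\<^sub>1 + \<beta> W\<^sub>2 = - 4H (\<alpha> + 2 (\<alpha> + \<beta>) H\<^sup>2) \<xi>\<close>. The cases of the theorem are the real solutions
  \<open>H\<close> of the vanishing of this coefficient.
\<close>


section \<open>Directional derivatives\<close>

lemma ddir_eqI: "(g has_derivative g') (at p) \<Longrightarrow> ddir X g p = g' (X p)"
  unfolding ddir_def by (simp add: frechet_derivative_eqI)

lemma ddir_const [simp]: "ddir X (\<lambda>_. c) = (\<lambda>_. 0)"
  by (simp add: ddir_def fun_eq_iff)

lemma ddir_zero_field: "g differentiable at p \<Longrightarrow> ddir (\<lambda>_. 0) g p = 0"
  unfolding ddir_def by (simp add: linear_0 linear_frechet_derivative)

lemma ddir_inner:
  assumes "g differentiable at p" and "k differentiable at p"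
  shows "ddir X (\<lambda>x. g x \<bullet> k x) p = ddir X g p \<bullet> k p + g p \<bullet> ddir X k p"
proof -
  have "((\<lambda>x. g x \<bullet> k x) has_derivative
      (\<lambda>v. g p \<bullet> frechet_derivative k (at p) v + frechet_derivative g (at p) v \<bullet> k p)) (at p)"
    using assms by (intro has_derivative_inner) (simp_all add: frechet_derivative_works[symmetric])
  from ddir_eqI[OF this, of X] show ?thesis by (simp add: ddir_def)
qed

lemma ddir_scaleR:
  fixes c :: "'a::euclidean_space \<Rightarrow> real"
  assumes "c differentiable at p" and "g differentiable at p"
  shows "ddir X (\<lambda>x. c x *\<^sub>R g x) p = ddir X c p *\<^sub>R g p + c p *\<^sub>R ddir X g p"
proof -
  have "((\<lambda>x. c x *\<^sub>R g x) has_derivative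
      (\<lambda>v. c p *\<^sub>R frechet_derivative g (at p) v + frechet_derivative c (at p) v *\<^sub>R g p)) (at p)"
    using assms by (intro has_derivative_scaleR) (simp_all add: frechet_derivative_works[symmetric])
  from ddir_eqI[OF this, of X] show ?thesis by (simp add: ddir_def)
qed

lemma ddir_add:
  assumes "g differentiable at p" and "k differentiable at p"
  shows "ddir X (\<lambda>x. g x + k x) p = ddir X g p + ddir X k p"
proof -
  have "((\<lambda>x. g x + k x) has_derivative
      (\<lambda>v. frechet_derivative g (at p) v + frechet_derivative k (at p) v)) (at p)"
    using assms by (intro has_derivative_add) (simp_all add: frechet_derivative_works[symmetric])
  from ddir_eqI[OF this, of X] show ?thesis by (simp add: ddir_def)
qed

lemma ddir_scaleR_const:
  assumes "g differentiable at p"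
  shows "ddir X (\<lambda>x. (c::real) *\<^sub>R g x) p = c *\<^sub>R ddir X g p"
  using ddir_scaleR[of "\<lambda>_. c" p g X] assms by simp

lemma smooth_differentiable: "smooth g \<Longrightarrow> g differentiable at p"
  unfolding smooth_def by (metis Ck.simps(2))

lemma smooth_continuous: "smooth g \<Longrightarrow> continuous_on UNIV g"
  unfolding smooth_def by (metis Ck.simps(1))

lemma smooth_ddir_const: "smooth g \<Longrightarrow> smooth (ddir (\<lambda>_. v) g)"
  unfolding smooth_def ddir_def by (metis Ck.simps(2))


section \<open>Symmetry of second derivatives\<close>

lemma segment_has_real_derivative:
  fixes g :: "'a::euclidean_space \<Rightarrow> real"
  assumes "\<And>x. g differentiable at x"
  shows "((\<lambda>s. g (p + s *\<^sub>R u)) has_real_derivative ddir (\<lambda>_. u) g (p + s *\<^sub>R u)) (at s)"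
proof -
  have "((\<lambda>s. p + s *\<^sub>R u) has_derivative (\<lambda>h. h *\<^sub>R u)) (at s)"
    by (auto intro!: derivative_eq_intros)
  from has_derivative_compose[OF this, of g "frechet_derivative g (at (p + s *\<^sub>R u))"]
  have "((\<lambda>s. g (p + s *\<^sub>R u)) has_derivative
      (\<lambda>h. frechet_derivative g (at (p + s *\<^sub>R u)) (h *\<^sub>R u))) (at s)"
    using assms by (simp add: frechet_derivative_works[symmetric])
  moreover have "frechet_derivative g (at (p + s *\<^sub>R u)) (h *\<^sub>R u)
      = ddir (\<lambda>_. u) g (p + s *\<^sub>R u) * h" for h
    using linear_frechet_derivative[OF assms] by (simp add: ddir_def linear_cmul)
  ultimately show ?thesis by (simp add: has_field_derivative_def)
qed

text \<open>The second difference over a parallelogram with sides \<open>h u\<close> and \<open>h v\<close> is the increment along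
  \<open>h u\<close> of the difference of \<open>g\<close> between two parallel sides. The mean value theorem for that increment
  leaves an increment of \<open>\<partial>\<^sub>u g\<close> along \<open>h v\<close>, to which the mean value theorem applies again.\<close>

lemma second_difference_mean_value:
  fixes g :: "'a::euclidean_space \<Rightarrow> real"
  assumes g: "\<And>x. g differentiable at x"
    and dg: "\<And>x. ddir (\<lambda>_. u) g differentiable at x"
    and h: "h > 0"
  obtains x where "norm (x - p) \<le> h * (norm u + norm v)"
    and "g (p + h *\<^sub>R u + h *\<^sub>R v) - g (p + h *\<^sub>R u) - g (p + h *\<^sub>R v) + g p
         = h\<^sup>2 * ddir (\<lambda>_. v) (ddir (\<lambda>_. u) g) x"
proof -
  let ?d = "ddir (\<lambda>_. u) g"
  define F where "F s = g ((p + h *\<^sub>R v) + s *\<^sub>R u) - g (p + s *\<^sub>R u)" for s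
  have F: "(F has_real_derivative ?d ((p + h *\<^sub>R v) + s *\<^sub>R u) - ?d (p + s *\<^sub>R u)) (at s)" for s
    unfolding F_def by (intro DERIV_diff segment_has_real_derivative g)
  obtain s where s: "0 < s" "s < h"
    "F h - F 0 = (h - 0) * (?d ((p + h *\<^sub>R v) + s *\<^sub>R u) - ?d (p + s *\<^sub>R u))"
    using MVT2[OF h F] by metis
  define G where "G t = ?d ((p + s *\<^sub>R u) + t *\<^sub>R v)" for t
  have G: "(G has_real_derivative ddir (\<lambda>_. v) ?d ((p + s *\<^sub>R u) + t *\<^sub>R v)) (at t)" for t
    unfolding G_def by (intro segment_has_real_derivative dg)
  obtain t where t: "0 < t" "t < h"
    "G h - G 0 = (h - 0) * ddir (\<lambda>_. v) ?d ((p + s *\<^sub>R u) + t *\<^sub>R v)"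
    using MVT2[OF h G] by metis
  let ?x = "p + s *\<^sub>R u + t *\<^sub>R v"
  have "norm (?x - p) \<le> s * norm u + t * norm v"
    using s t norm_triangle_ineq[of "s *\<^sub>R u" "t *\<^sub>R v"] by (simp add: algebra_simps)
  also have "\<dots> \<le> h * (norm u + norm v)"
    using s t by (simp add: distrib_left add_mono mult_right_mono)
  finally have "norm (?x - p) \<le> h * (norm u + norm v)" .
  moreover have "F h - F 0 = h * (G h - G 0)"
    using s(3) by (simp add: G_def algebra_simps)
  then have "g (p + h *\<^sub>R u + h *\<^sub>R v) - g (p + h *\<^sub>R u) - g (p + h *\<^sub>R v) + g p
         = h\<^sup>2 * ddir (\<lambda>_. v) ?d ?x"
    using t(3) by (simp add: F_def algebra_simps power2_eq_square)
  ultimately show ?thesis by (rule that)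
qed

text \<open>The second difference is symmetric in \<open>u\<close> and \<open>v\<close>. Hence both mixed derivatives take a common
  value at points as close to \<open>p\<close> as desired, and by continuity they agree at \<open>p\<close>.\<close>

lemma ddir_commute_real:
  fixes g :: "'a::euclidean_space \<Rightarrow> real"
  assumes g: "smooth g"
  shows "ddir (\<lambda>_. v) (ddir (\<lambda>_. u) g) p = ddir (\<lambda>_. u) (ddir (\<lambda>_. v) g) p"
proof -
  let ?A = "ddir (\<lambda>_. v) (ddir (\<lambda>_. u) g)" and ?B = "ddir (\<lambda>_. u) (ddir (\<lambda>_. v) g)"
  let ?h = "\<lambda>n. inverse (real (Suc n))"
  have ex: "\<exists>x y. norm (x - p) \<le> ?h n * (norm u + norm v) \<and> norm (y - p) \<le> ?h n * (norm u + norm v)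
      \<and> ?A x = ?B y" for n
  proof -
    have pos: "?h n > 0" by simp
    obtain x where x: "norm (x - p) \<le> ?h n * (norm u + norm v)"
      "g (p + ?h n *\<^sub>R u + ?h n *\<^sub>R v) - g (p + ?h n *\<^sub>R u) - g (p + ?h n *\<^sub>R v) + g p = (?h n)\<^sup>2 * ?A x"
      using second_difference_mean_value[OF _ _ pos, of g u p v]
      by (metis g smooth_ddir_const smooth_differentiable)
    obtain y where y: "norm (y - p) \<le> ?h n * (norm v + norm u)"
      "g (p + ?h n *\<^sub>R v + ?h n *\<^sub>R u) - g (p + ?h n *\<^sub>R v) - g (p + ?h n *\<^sub>R u) + g p = (?h n)\<^sup>2 * ?B y"
      using second_difference_mean_value[OF _ _ pos, of g v p u]
      by (metis g smooth_ddir_const smooth_differentiable)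
    have swap: "p + ?h n *\<^sub>R v + ?h n *\<^sub>R u = p + ?h n *\<^sub>R u + ?h n *\<^sub>R v" by (simp add: add_ac)
    have "(?h n)\<^sup>2 * ?A x = (?h n)\<^sup>2 * ?B y"
      using x(2) y(2)[unfolded swap] by linarith
    then have "?A x = ?B y" using pos by simp
    with x(1) y(1) show ?thesis by (auto simp: add.commute)
  qed
  then obtain x y where xy: "\<And>n. norm (x n - p) \<le> ?h n * (norm u + norm v)"
    "\<And>n. norm (y n - p) \<le> ?h n * (norm u + norm v)" "\<And>n. ?A (x n) = ?B (y n)"
    by metis
  have lim: "(\<lambda>n. ?h n * (norm u + norm v)) \<longlonglongrightarrow> 0"
    by (rule tendsto_mult_left_zero[OF LIMSEQ_inverse_real_of_nat])
  have conv: "z \<longlonglongrightarrow> p" if "\<And>n. norm (z n - p) \<le> ?h n * (norm u + norm v)" for z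
  proof -
    have "(\<lambda>n. z n - p) \<longlonglongrightarrow> 0"
      using that by (intro Lim_null_comparison[OF _ lim] always_eventually allI)
    then show ?thesis by (simp add: LIM_zero_iff)
  qed
  have cont: "isCont ?A p" "isCont ?B p"
    using smooth_continuous[OF smooth_ddir_const[OF smooth_ddir_const[OF g]]]
    by (simp_all add: continuous_on_eq_continuous_at)
  have "(\<lambda>n. ?A (x n)) \<longlonglongrightarrow> ?A p" "(\<lambda>n. ?B (y n)) \<longlonglongrightarrow> ?B p"
    using conv[OF xy(1)] conv[OF xy(2)] cont isCont_tendsto_compose by blast+
  then show ?thesis using xy(3) LIMSEQ_unique by auto
qed

lemma ddir_inner_const:
  "g differentiable at p \<Longrightarrow> ddir X (\<lambda>x. g x \<bullet> w) p = ddir X g p \<bullet> w"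
  using ddir_inner[of g p "\<lambda>_. w" X] by simp

lemma Ck_inner_const: "Ck k g \<Longrightarrow> Ck k (\<lambda>x. g x \<bullet> w)"
proof (induction k arbitrary: g)
  case 0
  then show ?case by (auto intro!: continuous_intros)
next
  case (Suc k)
  have d: "frechet_derivative (\<lambda>x. g x \<bullet> w) (at x) v = frechet_derivative g (at x) v \<bullet> w" for x v
    using ddir_inner_const[of g x "\<lambda>_. v" w] Suc.prems by (simp add: ddir_def)
  show ?case using Suc by (auto simp: d intro: differentiable_inner)
qed

lemma ddir_commute:
  assumes g: "smooth g"
  shows "ddir (\<lambda>_. v) (ddir (\<lambda>_. u) g) = ddir (\<lambda>_. u) (ddir (\<lambda>_. v) g)"
proof (rule ext, rule euclidean_eqI)
  fix p and w :: 'b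
  have inner: "ddir (\<lambda>_. y) (ddir (\<lambda>_. x) (\<lambda>q. g q \<bullet> w)) p = ddir (\<lambda>_. y) (ddir (\<lambda>_. x) g) p \<bullet> w" for x y
  proof -
    have "ddir (\<lambda>_. x) (\<lambda>q. g q \<bullet> w) = (\<lambda>q. ddir (\<lambda>_. x) g q \<bullet> w)"
      using g by (simp add: fun_eq_iff ddir_inner_const smooth_differentiable)
    then show ?thesis
      using g by (simp add: ddir_inner_const smooth_differentiable smooth_ddir_const)
  qed
  have "smooth (\<lambda>q. g q \<bullet> w)" using g by (simp add: smooth_def Ck_inner_const)
  from ddir_commute_real[OF this, of v u p]
  show "ddir (\<lambda>_. v) (ddir (\<lambda>_. u) g) p \<bullet> w = ddir (\<lambda>_. u) (ddir (\<lambda>_. v) g) p \<bullet> w"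
    by (simp add: inner)
qed


section \<open>Covariant derivatives of the differential in the coordinate frame\<close>

abbreviation pd :: "2 \<Rightarrow> (real^2 \<Rightarrow> 'b::euclidean_space) \<Rightarrow> real^2 \<Rightarrow> 'b" where
  "pd i \<equiv> ddir (frame i)"

lemma ddir_frame [simp]: "ddir X (frame i) = (\<lambda>_. 0)"
  unfolding frame_def by simp

lemma smooth_pd: "smooth g \<Longrightarrow> smooth (pd i g)"
  unfolding frame_def by (rule smooth_ddir_const)

lemma pd_commute: "smooth g \<Longrightarrow> pd i (pd j g) = pd j (pd i g)"
  unfolding frame_def by (rule ddir_commute)

lemma pd_inner:
  assumes "smooth g" and "smooth k"
  shows "pd i (\<lambda>x. g x \<bullet> k x) p = pd i g p \<bullet> k p + g p \<bullet> pd i k p"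
  using assms by (intro ddir_inner smooth_differentiable)

lemma pd_inner_const:
  assumes "smooth g" and "smooth k" and "\<And>x. g x \<bullet> k x = c"
  shows "pd i g p \<bullet> k p = - (g p \<bullet> pd i k p)"
proof -
  have "pd i (\<lambda>x. g x \<bullet> k x) p = 0" using assms(3) by simp
  then show ?thesis using pd_inner[OF assms(1,2), of i p] by simp
qed

text \<open>The coordinate frame is parallel, so the correction terms in the iterated covariant derivatives
  are of the form \<open>nabla_d\<close> or \<open>nabla2_d\<close> with one zero field. They vanish, and each covariant
  derivative reduces to an application of the pull-back connection to the previous one.\<close>

lemma nabla_d_zero_left:
  assumes "smooth f"
  shows "nabla_d f (\<lambda>_. 0) (\<lambda>_. v) = (\<lambda>_. 0)"
  unfolding nabla_d_def pb_conn_def fun_eq_iff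
  using assms by (simp add: ddir_zero_field smooth_ddir_const smooth_differentiable tan_proj_def)

lemma nabla_d_zero_right:
  assumes "smooth f"
  shows "nabla_d f (\<lambda>_. v) (\<lambda>_. 0) = (\<lambda>_. 0)"
proof -
  have "ddir (\<lambda>_. 0) f = (\<lambda>_. 0)"
    using assms by (simp add: fun_eq_iff ddir_zero_field smooth_differentiable)
  then show ?thesis by (simp add: nabla_d_def pb_conn_def tan_proj_def)
qed

lemma nabla_d_frame:
  assumes "smooth f"
  shows "nabla_d f (frame i) (frame j) = (\<lambda>p. tan_proj (f p) (pd i (pd j f) p))"
  using assms by (simp add: nabla_d_def pb_conn_def fun_eq_iff ddir_zero_field smooth_differentiable)

lemma nabla2_d_frame:
  assumes "smooth f"
  shows "nabla2_d f (frame k) (frame i) (frame j) = pb_conn f (frame k) (nabla_d f (frame i) (frame j))"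
  using assms by (simp add: nabla2_d_def fun_eq_iff frame_def nabla_d_zero_left nabla_d_zero_right)

text \<open>Differentiability of the second fundamental form is what makes its derivative along the zero
  field vanish: at a point where a map is not differentiable, \<open>frechet_derivative\<close> is an arbitrary
  function.\<close>

lemma nabla3_d_frame:
  assumes f: "smooth f"
    and d: "\<And>p. nabla_d f (frame i) (frame j) differentiable at p"
  shows "nabla3_d f (frame m) (frame k) (frame i) (frame j)
    = pb_conn f (frame m) (nabla2_d f (frame k) (frame i) (frame j))"
proof -
  have 1: "nabla2_d f (\<lambda>_. 0) (frame i) (frame j) = (\<lambda>_. 0)"
    unfolding nabla2_d_def pb_conn_def fun_eq_iff
    using d f by (simp add: ddir_zero_field tan_proj_def)
       (simp add: frame_def nabla_d_zero_left nabla_d_zero_right f)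
  have 2: "nabla2_d f (frame k) (\<lambda>_. 0) (frame j) = (\<lambda>_. 0)"
    "nabla2_d f (frame k) (frame i) (\<lambda>_. 0) = (\<lambda>_. 0)"
    unfolding nabla2_d_def pb_conn_def fun_eq_iff frame_def
    using f by (simp_all add: nabla_d_zero_left nabla_d_zero_right tan_proj_def)
  show ?thesis by (simp add: nabla3_d_def fun_eq_iff 1 2)
qed


section \<open>Flat surfaces in the three-sphere\<close>

lemma orthogonal_to_basis_imp_zero:
  fixes S :: "'a::euclidean_space set"
  assumes "pairwise orthogonal S" and "0 \<notin> S" and "card S = DIM('a)"
    and "\<And>b. b \<in> S \<Longrightarrow> v \<bullet> b = 0"
  shows "v = 0"
proof (rule ccontr)
  assume v: "v \<noteq> 0"
  then have "v \<notin> S" using assms(4) by force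
  moreover have "pairwise orthogonal (insert v S)"
    using assms(1,4) by (auto simp: pairwise_insert orthogonal_def inner_commute)
  then have "independent (insert v S)"
    using v assms(2) by (intro pairwise_orthogonal_independent) auto
  from independent_bound[OF this] have "finite S" "card (insert v S) \<le> DIM('a)"
    by simp_all
  ultimately show False using assms(3) by simp
qed

lemma orthonormal_frame4_eqI:
  fixes a b c d x y :: "real^4"
  assumes n: "a \<bullet> a = 1" "b \<bullet> b = 1" "c \<bullet> c = 1" "d \<bullet> d = 1"
    and o: "a \<bullet> b = 0" "a \<bullet> c = 0" "a \<bullet> d = 0" "b \<bullet> c = 0" "b \<bullet> d = 0" "c \<bullet> d = 0"
    and e: "x \<bullet> a = y \<bullet> a" "x \<bullet> b = y \<bullet> b" "x \<bullet> c = y \<bullet> c" "x \<bullet> d = y \<bullet> d"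
  shows "x = y"
proof -
  have "distinct [a, b, c, d]" using n o by auto
  then have card: "card {a, b, c, d} = DIM(real^4)" by simp
  have "pairwise orthogonal {a, b, c, d}"
    using o by (auto simp: pairwise_insert orthogonal_def inner_commute)
  moreover have "0 \<notin> {a, b, c, d}" using n by auto
  moreover note card
  moreover have "(x - y) \<bullet> z = 0" if "z \<in> {a, b, c, d}" for z
    using that e by (auto simp: inner_diff_left)
  ultimately have "x - y = 0" by (rule orthogonal_to_basis_imp_zero)
  then show ?thesis by simp
qed

locale flat_surface_in_sphere =
  fixes f \<xi> :: "real^2 \<Rightarrow> real^4"
  assumes smooth_f: "smooth f" and smooth_normal: "smooth \<xi>"
    and f_unit: "f p \<bullet> f p = 1"
    and metric: "pd i f p \<bullet> pd j f p = (if i = j then 1 else 0)"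
    and normal_unit: "\<xi> p \<bullet> \<xi> p = 1"
    and normal_f: "\<xi> p \<bullet> f p = 0"
    and normal_tangent: "\<xi> p \<bullet> pd i f p = 0"
begin

text \<open>The coefficients of the second fundamental form. Since \<open>\<xi>\<close> is orthogonal to the position vector,
  the ambient second derivative has the same \<open>\<xi>\<close>-component as its projection to the sphere.\<close>

definition h :: "2 \<Rightarrow> 2 \<Rightarrow> real^2 \<Rightarrow> real" where
  "h i j p = pd i (pd j f) p \<bullet> \<xi> p"

lemmas smooths = smooth_f smooth_normal smooth_pd

lemma h_commute: "h i j = h j i"
  by (simp add: h_def fun_eq_iff pd_commute[OF smooth_f, of i j])

lemma pd_f_orthogonal_f: "pd i f p \<bullet> f p = 0"
  using pd_inner_const[OF smooth_f smooth_f f_unit, of i p] by (simp add: inner_commute)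

lemmas moving_frame_orthonormal = metric f_unit normal_unit normal_f normal_tangent
  pd_f_orthogonal_f normal_f[unfolded inner_commute[of "\<xi> _"]]
  normal_tangent[unfolded inner_commute[of "\<xi> _"]]
  pd_f_orthogonal_f[unfolded inner_commute[of _ "f _"]]

lemma moving_frame_eqI:
  assumes "x \<bullet> f p = y \<bullet> f p" and "\<And>l. x \<bullet> pd l f p = y \<bullet> pd l f p" and "x \<bullet> \<xi> p = y \<bullet> \<xi> p"
  shows "x = y"
  by (rule orthonormal_frame4_eqI[of "f p" "pd 1 f p" "pd 2 f p" "\<xi> p"])
     (simp_all add: assms moving_frame_orthonormal)

lemma hessian_f: "pd i (pd j f) p \<bullet> f p = - (if i = j then 1 else 0)"
  using pd_inner_const[OF smooth_pd[OF smooth_f] smooth_f pd_f_orthogonal_f, of i j p]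
  by (simp add: metric)

text \<open>This is the vanishing of the Christoffel symbols of a flat metric, by the Koszul
  argument: the trilinear array \<open>f\<^sub>k\<^sub>i \<bullet> f\<^sub>j\<close> is symmetric in \<open>k, i\<close> and, as the metric coefficients are constant,
  antisymmetric in \<open>i, j\<close>; only zero has both symmetries.\<close>

lemma hessian_tangent: "pd k (pd i f) p \<bullet> pd j f p = 0"
proof -
  let ?T = "\<lambda>k i j. pd k (pd i f) p \<bullet> pd j f p"
  have swap: "?T k i j = - ?T k j i" for k i j
    using pd_inner_const[OF smooth_pd[OF smooth_f] smooth_pd[OF smooth_f] metric, of k i p j]
    by (simp add: inner_commute)
  have sym: "?T k i j = ?T i k j" for k i j
    by (simp add: pd_commute[OF smooth_f, of k i])
  have "?T k i j = - ?T j k i" using swap[of k i j] by (simp only: sym[of k j i])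
  also have "\<dots> = ?T i j k" using swap[of j k i] by (simp only: sym[of j i k] minus_minus)
  also have "\<dots> = - ?T k i j" using swap[of i j k] by (simp only: sym[of i k j])
  finally show ?thesis by simp
qed

lemma gauss_formula: "pd i (pd j f) p = h i j p *\<^sub>R \<xi> p - (if i = j then 1 else 0) *\<^sub>R f p"
  by (rule moving_frame_eqI[of _ p])
     (simp_all add: h_def hessian_f hessian_tangent moving_frame_orthonormal inner_diff_left)

lemma pd_normal_f: "pd k \<xi> p \<bullet> f p = 0"
  using pd_inner_const[OF smooth_normal smooth_f normal_f, of k p] by (simp add: normal_tangent)

lemma pd_normal_normal: "pd k \<xi> p \<bullet> \<xi> p = 0"
  using pd_inner_const[OF smooth_normal smooth_normal normal_unit, of k p]
  by (simp add: inner_commute)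

lemma pd_normal_tangent: "pd k \<xi> p \<bullet> pd l f p = - h k l p"
  using pd_inner_const[OF smooth_normal smooth_pd[OF smooth_f] normal_tangent, of k p l]
  by (simp add: h_def inner_commute)

lemma weingarten: "pd k \<xi> p = - (\<Sum>l\<in>UNIV. h k l p *\<^sub>R pd l f p)"
proof (rule moving_frame_eqI[of _ p])
  fix l
  show "pd k \<xi> p \<bullet> pd l f p = - (\<Sum>m\<in>UNIV. h k m p *\<^sub>R pd m f p) \<bullet> pd l f p"
    by (simp add: pd_normal_tangent inner_sum_left metric if_distrib[of "(*) _"] cong: if_cong)
qed (simp_all add: pd_normal_f pd_normal_normal inner_sum_left moving_frame_orthonormal)

text \<open>Differentiating \<open>f\<^sub>i\<^sub>j \<bullet> f\<^sub>l = 0\<close> expresses the tangential part of the third derivatives through \<open>h\<close>;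
  the Gauss equation says that the expressions for \<open>f\<^sub>1\<^sub>2\<^sub>2 \<bullet> f\<^sub>1\<close> and \<open>f\<^sub>2\<^sub>1\<^sub>2 \<bullet> f\<^sub>1\<close> agree. The right-hand
  side is minus the curvature of the sphere, because the metric of the surface is flat.\<close>

lemma gauss_equation: "h 1 1 p * h 2 2 p - (h 1 2 p)\<^sup>2 = -1"
proof -
  have third: "pd k (pd i (pd j f)) p \<bullet> pd l f p = - (pd i (pd j f) p \<bullet> pd k (pd l f) p)" for i j k l
    by (rule pd_inner_const[OF _ _ hessian_tangent]) (simp_all add: smooths)
  have "pd 1 (pd 2 (pd 2 f)) p \<bullet> pd 1 f p = pd 2 (pd 1 (pd 2 f)) p \<bullet> pd 1 f p"
    by (simp add: pd_commute[of "pd 2 f" 1 2] smooths)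
  then show ?thesis
    by (simp add: third gauss_formula inner_diff_left inner_diff_right moving_frame_orthonormal
        h_commute[of 2 1] power2_eq_square)
qed

lemma h_differentiable: "h i j differentiable at p"
  unfolding h_def by (intro differentiable_inner smooth_differentiable smooths)

text \<open>The normal part of the symmetry of third derivatives: \<open>\<partial>\<^sub>k h\<^sub>i\<^sub>j = f\<^sub>k\<^sub>i\<^sub>j \<bullet> \<xi>\<close>, since \<open>f\<^sub>i\<^sub>j\<close> lies in the span
  of \<open>f\<close> and \<open>\<xi>\<close>, to which \<open>\<xi>\<^sub>k\<close> is orthogonal.\<close>

lemma codazzi: "pd k (h i j) p = pd i (h k j) p"
proof -
  have "pd k (h i j) p = pd k (pd i (pd j f)) p \<bullet> \<xi> p" for k i
  proof -
    have "pd k \<xi> p \<bullet> pd i (pd j f) p = 0"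
      by (simp add: gauss_formula inner_diff_right pd_normal_f pd_normal_normal)
    then show ?thesis
      unfolding h_def by (simp add: pd_inner smooths inner_commute[of "pd i (pd j f) p"])
  qed
  then show ?thesis by (simp add: pd_commute[of "pd j f" k i] smooths)
qed

text \<open>With \<open>u = h\<^sub>1\<^sub>1 - H\<close> and \<open>v = h\<^sub>1\<^sub>2\<close>, half the difference of the diagonal entries and the off-diagonal
  entry, the constant determinant reads \<open>u\<^sup>2 + v\<^sup>2 = H\<^sup>2 + 1\<close>. Since the trace is constant, the Codazzi
  equations determine all derivatives of \<open>h\<close> from \<open>x = \<partial>\<^sub>1 u\<close> and \<open>y = \<partial>\<^sub>1 v\<close> up to sign (they are the
  Cauchy-Riemann equations for \<open>u - \<i> v\<close>), and the two derivatives of the determinant give \<open>u x + v y = 0\<close> and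
  \<open>u y - v x = 0\<close>, a system of determinant \<open>u\<^sup>2 + v\<^sup>2 > 0\<close>.\<close>

lemma pd_h_eq_zero:
  assumes H: "\<And>p. h 1 1 p + h 2 2 p = 2 * H"
  shows "pd k (h i j) p = 0"
proof -
  have trace: "pd k (h 1 1) p + pd k (h 2 2) p = 0" for k
  proof -
    have "pd k (\<lambda>p. h 1 1 p + h 2 2 p) p = 0" using H by simp
    then show ?thesis by (simp add: ddir_add h_differentiable)
  qed
  define u v where "u = h 1 1 p - H" and "v = h 1 2 p"
  \<comment> \<open>The products are written with the inner product of the reals so that \<open>ddir_inner\<close> applies.\<close>
  have det: "h 1 1 p * pd k (h 2 2) p + pd k (h 1 1) p * h 2 2 p = 2 * (v * pd k (h 1 2) p)" for k
  proof -
    have "pd k (\<lambda>p. h 1 1 p \<bullet> h 2 2 p) p = pd k (\<lambda>p. -1 + h 1 2 p \<bullet> h 1 2 p) p"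
    proof (rule arg_cong[of _ _ "\<lambda>g. pd k g p"], rule ext)
      show "h 1 1 q \<bullet> h 2 2 q = -1 + h 1 2 q \<bullet> h 1 2 q" for q
        using gauss_equation[of q] by (simp add: power2_eq_square)
    qed
    moreover have "pd k (\<lambda>p. h 1 1 p \<bullet> h 2 2 p) p = pd k (h 1 1) p \<bullet> h 2 2 p + h 1 1 p \<bullet> pd k (h 2 2) p"
      by (intro ddir_inner h_differentiable)
    moreover have "pd k (\<lambda>p. -1 + h 1 2 p \<bullet> h 1 2 p) p = pd k (h 1 2) p \<bullet> h 1 2 p + h 1 2 p \<bullet> pd k (h 1 2) p"
      by (subst ddir_add) (simp_all only: ddir_const ddir_inner h_differentiable
          differentiable_inner differentiable_const add_0)
    ultimately show ?thesis by (simp add: v_def mult.commute)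
  qed
  have C: "pd 2 (h 1 1) p = pd 1 (h 1 2) p" "pd 2 (h 1 2) p = pd 1 (h 2 2) p"
    using codazzi[of 2 1 1 p] codazzi[of 1 2 2 p] by (simp_all add: h_commute[of 2 1])
  let ?x = "pd 1 (h 1 1) p" and ?y = "pd 1 (h 1 2) p"
  let ?z = "pd 1 (h 2 2) p" and ?w = "pd 2 (h 2 2) p"
  have z: "?z = - ?x" and w: "?w = - ?y" using trace[of 1] trace[of 2] C by simp_all
  have c: "h 2 2 p = 2 * H - h 1 1 p" using H[of p] by simp
  have "h 1 1 p * ?z + ?x * h 2 2 p = 2 * (v * ?y)" using det[of 1] by simp
  then have eq1: "u * ?x + v * ?y = 0" unfolding z c u_def by (simp add: algebra_simps)
  have "h 1 1 p * ?w + ?y * h 2 2 p = 2 * (v * ?z)" using det[of 2] C by simp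
  then have eq2: "u * ?y - v * ?x = 0" unfolding z w c u_def by (simp add: algebra_simps)
  have "u\<^sup>2 + v\<^sup>2 = H\<^sup>2 + 1"
    using gauss_equation[of p] unfolding u_def v_def c by (simp add: algebra_simps power2_eq_square)
  then have "u\<^sup>2 + v\<^sup>2 \<noteq> 0" by (metis add_nonneg_pos less_irrefl zero_le_power2 zero_less_one)
  moreover have "(u\<^sup>2 + v\<^sup>2) * ?x = 0" "(u\<^sup>2 + v\<^sup>2) * ?y = 0"
    using eq1 eq2 by algebra+
  ultimately have "?x = 0" "?y = 0" by (metis mult_eq_0_iff)+
  then have "pd 1 (h 1 1) p = 0" "pd 1 (h 1 2) p = 0" "pd 1 (h 2 2) p = 0"
    "pd 2 (h 1 1) p = 0" "pd 2 (h 1 2) p = 0" "pd 2 (h 2 2) p = 0"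
    using z w C by simp_all
  then have "\<forall>k i j. pd k (h i j) p = 0"
    by (simp add: forall_2 h_commute[of 2 1])
  then show ?thesis by blast
qed

lemma second_fundamental_form: "nabla_d f (frame i) (frame j) = (\<lambda>p. h i j p *\<^sub>R \<xi> p)"
  by (simp add: nabla_d_frame smooth_f gauss_formula fun_eq_iff tan_proj_def inner_diff_left
      moving_frame_orthonormal)

lemma nabla2_d_constant_h:
  assumes H: "\<And>p. h 1 1 p + h 2 2 p = 2 * H"
  shows "nabla2_d f (frame k) (frame i) (frame j) = (\<lambda>p. h i j p *\<^sub>R pd k \<xi> p)"
  by (simp add: nabla2_d_frame smooth_f second_fundamental_form pb_conn_def fun_eq_iff ddir_scaleR
      h_differentiable smooth_differentiable smooths pd_h_eq_zero[OF H] tan_proj_def pd_normal_f)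

text \<open>Differentiate the constant functions \<open>\<xi>\<^sub>k \<bullet> f\<^sub>l = - h\<^sub>k\<^sub>l\<close> and \<open>\<xi>\<^sub>k \<bullet> \<xi> = 0\<close>: the first shows that \<open>\<xi>\<^sub>k\<^sub>m\<close>
  has no component tangent to the surface, the second that its normal component is
  \<open>- \<xi>\<^sub>k \<bullet> \<xi>\<^sub>m\<close>.\<close>

lemma second_derivative_normal:
  assumes H: "\<And>p. h 1 1 p + h 2 2 p = 2 * H"
  shows "tan_proj (f p) (pd m (pd k \<xi>) p) = - (\<Sum>l\<in>UNIV. h k l p * h m l p) *\<^sub>R \<xi> p"
proof (rule moving_frame_eqI[of _ p])
  have proj: "tan_proj (f p) w \<bullet> x = w \<bullet> x - (w \<bullet> f p) * (f p \<bullet> x)" for w x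
    by (simp add: tan_proj_def inner_diff_left)
  show "tan_proj (f p) (pd m (pd k \<xi>) p) \<bullet> f p = - (\<Sum>l\<in>UNIV. h k l p * h m l p) *\<^sub>R \<xi> p \<bullet> f p"
    by (simp add: proj moving_frame_orthonormal)
  show "tan_proj (f p) (pd m (pd k \<xi>) p) \<bullet> pd l f p = - (\<Sum>l\<in>UNIV. h k l p * h m l p) *\<^sub>R \<xi> p \<bullet> pd l f p" for l
  proof -
    have "pd m (\<lambda>p. pd k \<xi> p \<bullet> pd l f p) p = pd m (\<lambda>p. (-1) *\<^sub>R h k l p) p"
      by (simp add: pd_normal_tangent)
    also have "\<dots> = 0"
      by (simp only: ddir_scaleR_const h_differentiable pd_h_eq_zero[OF H] scaleR_zero_right)
    finally have "pd m (pd k \<xi>) p \<bullet> pd l f p = - (pd k \<xi> p \<bullet> pd m (pd l f) p)"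
      by (simp add: pd_inner smooths)
    also have "\<dots> = 0"
      by (simp add: gauss_formula inner_diff_right pd_normal_f pd_normal_normal)
    finally show ?thesis by (simp add: proj moving_frame_orthonormal)
  qed
  have "pd m (pd k \<xi>) p \<bullet> \<xi> p = - (pd k \<xi> p \<bullet> pd m \<xi> p)"
    by (rule pd_inner_const[OF _ _ pd_normal_normal]) (simp_all add: smooths)
  also have "\<dots> = - (\<Sum>l\<in>UNIV. h k l p * h m l p)"
    by (subst weingarten[of m]) (simp add: inner_sum_right pd_normal_tangent sum_negf mult.commute)
  finally show "tan_proj (f p) (pd m (pd k \<xi>) p) \<bullet> \<xi> p = - (\<Sum>l\<in>UNIV. h k l p * h m l p) *\<^sub>R \<xi> p \<bullet> \<xi> p"
    by (simp add: proj moving_frame_orthonormal)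
qed

lemma nabla3_d_constant_h:
  assumes H: "\<And>p. h 1 1 p + h 2 2 p = 2 * H"
  shows "nabla3_d f (frame m) (frame k) (frame i) (frame j) p
    = - (h i j p * (\<Sum>l\<in>UNIV. h k l p * h m l p)) *\<^sub>R \<xi> p"
proof -
  have "nabla_d f (frame i) (frame j) differentiable at p" for p
    unfolding second_fundamental_form
    by (intro differentiable_scaleR h_differentiable smooth_differentiable smooths)
  then have "nabla3_d f (frame m) (frame k) (frame i) (frame j) p
      = tan_proj (f p) (pd m (\<lambda>p. h i j p *\<^sub>R pd k \<xi> p) p)"
    by (simp add: nabla3_d_frame smooth_f nabla2_d_constant_h[OF H] pb_conn_def)
  also have "\<dots> = tan_proj (f p) (h i j p *\<^sub>R pd m (pd k \<xi>) p)"
    by (simp add: ddir_scaleR h_differentiable smooth_differentiable smooths pd_h_eq_zero[OF H])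
  also have "\<dots> = h i j p *\<^sub>R tan_proj (f p) (pd m (pd k \<xi>) p)"
    by (simp add: tan_proj_def scaleR_diff_right)
  finally show ?thesis by (simp add: second_derivative_normal[OF H])
qed

lemma sphere_curv_h:
  "sphere_curv (f p) (nabla_d f (frame i) (frame j) p) (pd k f p) (pd l f p)
    = (if k = l then h i j p else 0) *\<^sub>R \<xi> p"
  using f_unit[of p]
  by (simp add: second_fundamental_form sphere_curv_eq norm_eq_1 moving_frame_orthonormal)

text \<open>Summing up gives \<open>tr h - tr h\<^sup>3\<close> and \<open>2 tr h - tr h tr h\<^sup>2\<close>, which for a \<open>2 \<times> 2\<close> matrix are polynomials
  in the trace \<open>2H\<close> and the determinant \<open>- 1\<close>.\<close>

lemma W1_W2_constant_mean_curvature: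
  assumes H: "\<And>p. h 1 1 p + h 2 2 p = 2 * H"
  shows "W1 f p = (- 4 * H - 8 * H ^ 3) *\<^sub>R \<xi> p" and "W2 f p = (- 8 * H ^ 3) *\<^sub>R \<xi> p"
proof -
  let ?a = "h 1 1 p" and ?b = "h 1 2 p" and ?c = "h 2 2 p"
  have rel: "?a + ?c = 2 * H" "?a * ?c - ?b\<^sup>2 = -1"
    using H gauss_equation by auto
  have "W1 f p = (?a + ?c - (?a * (?a\<^sup>2 + ?b\<^sup>2) + 2 * ?b * (?a * ?b + ?b * ?c) + ?c * (?b\<^sup>2 + ?c\<^sup>2))) *\<^sub>R \<xi> p"
    unfolding W1_def sum_2 nabla3_d_constant_h[OF H] sphere_curv_h scaleR_add_left[symmetric]
    by (rule arg_cong[of _ _ "\<lambda>t. t *\<^sub>R \<xi> p"])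
       (simp add: h_commute[of 2 1] algebra_simps power2_eq_square)
  also have "?a + ?c - (?a * (?a\<^sup>2 + ?b\<^sup>2) + 2 * ?b * (?a * ?b + ?b * ?c) + ?c * (?b\<^sup>2 + ?c\<^sup>2))
      = - 4 * H - 8 * H ^ 3"
    using rel by algebra
  finally show "W1 f p = (- 4 * H - 8 * H ^ 3) *\<^sub>R \<xi> p" .
  have "W2 f p = (2 * (?a + ?c) - (?a + ?c) * (?a\<^sup>2 + 2 * ?b\<^sup>2 + ?c\<^sup>2)) *\<^sub>R \<xi> p"
    unfolding W2_def sum_2 nabla3_d_constant_h[OF H] sphere_curv_h scaleR_add_left[symmetric]
    by (rule arg_cong[of _ _ "\<lambda>t. t *\<^sub>R \<xi> p"])
       (simp add: h_commute[of 2 1] algebra_simps power2_eq_square)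
  also have "2 * (?a + ?c) - (?a + ?c) * (?a\<^sup>2 + 2 * ?b\<^sup>2 + ?c\<^sup>2) = - 8 * H ^ 3"
    using rel by algebra
  finally show "W2 f p = (- 8 * H ^ 3) *\<^sub>R \<xi> p" .
qed

end


section \<open>The classification\<close>

lemma range_of_squared_mean_curvature:
  "{- (s / (2 * (s + t))) | s t :: real.
      s^2 + t^2 \<noteq> 0 \<and> s + t \<noteq> 0 \<and> s / (s + t) < 0} = {0<..}"
proof (intro equalityI subsetI)
  fix y :: real
  assume "y \<in> {0<..}"
  then have y: "y > 0" by simp
  \<comment> \<open>The value depends only on the ratio of \<open>s\<close> to \<open>s + t\<close>, so one may normalize \<open>s + t = 1\<close>.\<close>
  define s t where "s = - 2 * y" and "t = 1 + 2 * y"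
  have "s + t = 1" by (simp add: s_def t_def)
  moreover have "s\<^sup>2 + t\<^sup>2 \<noteq> 0"
    using y by (simp add: s_def add_nonneg_eq_0_iff)
  moreover have "y = - (s / (2 * (s + t)))" "s / (s + t) < 0"
    using y \<open>s + t = 1\<close> by (simp_all add: s_def)
  ultimately show "y \<in> {- (s / (2 * (s + t))) | s t :: real.
      s^2 + t^2 \<noteq> 0 \<and> s + t \<noteq> 0 \<and> s / (s + t) < 0}"
    by (intro CollectI exI[of _ s] exI[of _ t] conjI) simp_all
next
  fix y :: real
  assume "y \<in> {- (s / (2 * (s + t))) | s t :: real.
      s^2 + t^2 \<noteq> 0 \<and> s + t \<noteq> 0 \<and> s / (s + t) < 0}"
  then obtain s t where "y = - (s / (2 * (s + t)))" "s / (s + t) < 0" by blast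
  moreover define q where "q = s / (s + t)"
  moreover have "s / (2 * (s + t)) = q / 2" by (simp add: q_def)
  ultimately have "y = - (q / 2)" "q < 0" by (simp_all only:)
  then show "y \<in> {0<..}" by simp
qed

theorem theorem5p4:
  fixes \<alpha> \<beta> H :: real
    and a b :: "real^2"
    and \<phi> \<xi> :: "(real^2) set \<Rightarrow> real^4"
  assumes "\<alpha>^2 + \<beta>^2 \<noteq> 0"
    and "a \<noteq> b" and "independent {a, b}"
    and "isometric_immersion_torus a b \<phi>"
    and "unit_normal_torus a b \<phi> \<xi>"
    and "mean_curvature_torus a b \<phi> \<xi> (\<lambda>_. H)"
  shows "(\<alpha> + \<beta> = 0 \<longrightarrow> (Q_map_torus a b \<alpha> \<beta> \<phi> \<longleftrightarrow> H = 0))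
    \<and> (\<alpha> + \<beta> \<noteq> 0 \<and> \<alpha> / (\<alpha> + \<beta>) \<ge> 0 \<longrightarrow> (Q_map_torus a b \<alpha> \<beta> \<phi> \<longleftrightarrow> H = 0))
    \<and> (\<alpha> + \<beta> \<noteq> 0 \<and> \<alpha> / (\<alpha> + \<beta>) < 0 \<longrightarrow>
         (Q_map_torus a b \<alpha> \<beta> \<phi> \<longleftrightarrow> H = 0 \<or> H^2 = - (\<alpha> / (2 * (\<alpha> + \<beta>)))))
    \<and> {- (s / (2 * (s + t))) | s t :: real.
         s^2 + t^2 \<noteq> 0 \<and> s + t \<noteq> 0 \<and> s / (s + t) < 0} = {0<..}"
proof -
  let ?f = "lift a b \<phi>" and ?\<xi> = "lift a b \<xi>"
  interpret flat_surface_in_sphere ?f ?\<xi>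
  proof
    show "smooth ?f" "smooth ?\<xi>"
      using assms(4,5) by (simp_all add: isometric_immersion_torus_def unit_normal_torus_def)
    show "?f p \<bullet> ?f p = 1" for p
      using assms(4) by (simp add: isometric_immersion_torus_def norm_eq_1)
    show "pd i ?f p \<bullet> pd j ?f p = (if i = j then 1 else 0)" for i j p
      using assms(4) by (simp add: isometric_immersion_torus_def ddir_def frame_def inner_axis_axis)
    show "?\<xi> p \<bullet> ?\<xi> p = 1" "?\<xi> p \<bullet> ?f p = 0" "?\<xi> p \<bullet> pd i ?f p = 0" for i p
      using assms(5) by (simp_all add: unit_normal_torus_def norm_eq_1 ddir_def)
  qed
  have H: "h 1 1 p + h 2 2 p = 2 * H" for p
  proof -
    have "mean_curvature_vector ?f p = H *\<^sub>R ?\<xi> p"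
      using assms(6) by (simp add: mean_curvature_torus_def lift_def)
    then have "(1/2) *\<^sub>R (h 1 1 p + h 2 2 p) *\<^sub>R ?\<xi> p = H *\<^sub>R ?\<xi> p"
      by (simp add: mean_curvature_vector_def second_fundamental_form sum_2 scaleR_add_left)
    moreover have "?\<xi> p \<noteq> 0" using normal_unit[of p] by auto
    ultimately have "(h 1 1 p + h 2 2 p) / 2 = H" by simp
    then show ?thesis by simp
  qed
  have "\<alpha> *\<^sub>R W1 ?f p + \<beta> *\<^sub>R W2 ?f p = (- 4 * H * (\<alpha> + 2 * (\<alpha> + \<beta>) * H\<^sup>2)) *\<^sub>R ?\<xi> p" for p
    unfolding W1_W2_constant_mean_curvature[OF H] scaleR_scaleR scaleR_add_left[symmetric]
    by (rule arg_cong[of _ _ "\<lambda>t. t *\<^sub>R ?\<xi> p"])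
       (simp add: algebra_simps power2_eq_square power3_eq_cube)
  moreover have "?\<xi> p \<noteq> 0" for p using normal_unit[of p] by auto
  ultimately have Q: "Q_map_torus a b \<alpha> \<beta> \<phi> \<longleftrightarrow> H = 0 \<or> \<alpha> + 2 * (\<alpha> + \<beta>) * H\<^sup>2 = 0"
    unfolding Q_map_torus_def by simp
  have root: "\<alpha> + 2 * (\<alpha> + \<beta>) * H\<^sup>2 = 0 \<longleftrightarrow> H\<^sup>2 = - (\<alpha> / (2 * (\<alpha> + \<beta>)))" if "\<alpha> + \<beta> \<noteq> 0"
    using that by (auto simp: field_simps)
  have "\<alpha> + 2 * (\<alpha> + \<beta>) * H\<^sup>2 \<noteq> 0" if "\<alpha> + \<beta> = 0"
    using that assms(1) by auto
  moreover have "H = 0" if "\<alpha> + \<beta> \<noteq> 0" "\<alpha> / (\<alpha> + \<beta>) \<ge> 0" "H\<^sup>2 = - (\<alpha> / (2 * (\<alpha> + \<beta>)))"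
  proof -
    define q where "q = \<alpha> / (\<alpha> + \<beta>)"
    have "\<alpha> / (2 * (\<alpha> + \<beta>)) = q / 2" by (simp add: q_def)
    then have "H\<^sup>2 = - (q / 2)" using that(3) by (simp only:)
    moreover have "q \<ge> 0" using that(2) by (simp add: q_def)
    ultimately have "H\<^sup>2 \<le> 0" by simp
    then show "H = 0" by simp
  qed
  ultimately show ?thesis
    using Q root range_of_squared_mean_curvature by blast
qed

end
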